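(* Let $X$ be a complete Lipschitz vector field, with Lipschitz constant $L$, on an open set $\Omega\subset\mathbb{R}^n$. Then the map $$\mathbb{R}\times L^1(\Omega)\ni(t,f)\mapsto T^X_tf:=f\circ\gamma^X_t\in L^1(\Omega)$$ defines a jointly continuous (i.e. $c_0$) one parameter group on the Banach space $L^1(\Omega)$, which satisfies $$\|T^X_t\|\le e^{nL|t|}$$ for each $t\in\mathbb{R}$ (operator norm on $L^1(\Omega)$).
   Context: A Lipschitz vector field on $\Omega$ with Lipschitz constant $L$ is a map $X:\Omega\to\mathbb{R}^n$ with $|X(x)-X(y)|\le L|x-y|$ for all $x,y\in\Omega$ (Euclidean norm). It is complete if for every $x\in\Omega$ the solution $t\mapsto\gamma^X_t(x)\in\Omega$ of $\dot\gamma(t)=X(\gamma(t))$, $\gamma(0)=x$, is defined for all $t\in\mathbb{R}$. A $c_0$ (jointly continuous) one parameter group on a Banach space $B$ is a family of linear operators $T_t:B\to B$, $t\in\mathbb{R}$, such that $(t,f)\mapsto T_t(f)$ is continuous on $\mathbb{R}\times B$, $T_0(f)=f$ and $T_t(T_s(f))=T_{t+s}(f)$ for all $f\in B$ and $s,t\in\mathbb{R}$. *)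

theory Defs
  imports "HOL-Analysis.Analysis"
begin

section \<open>Normed and Banach spaces with an explicit carrier\<close>

text \<open>
  The space \<open>L\<^sup>1(\<Omega>)\<close> depends on the set \<open>\<Omega>\<close>, so it cannot be an instance of the type class
  \<^class>\<open>banach\<close>.  The scalars range over a type of class \<^class>\<open>real_normed_field\<close>, which
  covers both real and complex spaces.
\<close>

record ('k, 'v) nspace =
  carr :: "'v set"
  add :: "'v \<Rightarrow> 'v \<Rightarrow> 'v"
  zer :: "'v"
  scl :: "'k \<Rightarrow> 'v \<Rightarrow> 'v"
  nrm :: "'v \<Rightarrow> real"

text \<open>
  The value off the carrier is irrelevant; it is set to 0 because the locale
  \<^locale>\<open>Metric_space\<close> demands symmetry and nonnegativity on the whole type.
\<close>

definition ndist :: "('k::real_normed_field, 'v) nspace \<Rightarrow> 'v \<Rightarrow> 'v \<Rightarrow> real" where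
  "ndist B u v = (if u \<in> carr B \<and> v \<in> carr B then nrm B (add B u (scl B (- 1) v)) else 0)"

definition ntopology :: "('k::real_normed_field, 'v) nspace \<Rightarrow> 'v topology" where
  "ntopology B = Metric_space.mtopology (carr B) (ndist B)"

locale Normed_space =
  fixes B :: "('k::real_normed_field, 'v) nspace"
  assumes add_closed: "u \<in> carr B \<Longrightarrow> v \<in> carr B \<Longrightarrow> add B u v \<in> carr B"
    and zer_closed: "zer B \<in> carr B"
    and scl_closed: "u \<in> carr B \<Longrightarrow> scl B a u \<in> carr B"
    and add_assoc: "u \<in> carr B \<Longrightarrow> v \<in> carr B \<Longrightarrow> w \<in> carr B \<Longrightarrow>
          add B (add B u v) w = add B u (add B v w)"
    and add_commute: "u \<in> carr B \<Longrightarrow> v \<in> carr B \<Longrightarrow> add B u v = add B v u"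
    and add_zer: "u \<in> carr B \<Longrightarrow> add B u (zer B) = u"
    and add_uminus: "u \<in> carr B \<Longrightarrow> add B u (scl B (- 1) u) = zer B"
    and scl_scl: "u \<in> carr B \<Longrightarrow> scl B a (scl B b u) = scl B (a * b) u"
    and scl_one: "u \<in> carr B \<Longrightarrow> scl B 1 u = u"
    and scl_add_right: "u \<in> carr B \<Longrightarrow> v \<in> carr B \<Longrightarrow>
          scl B a (add B u v) = add B (scl B a u) (scl B a v)"
    and scl_add_left: "u \<in> carr B \<Longrightarrow> scl B (a + b) u = add B (scl B a u) (scl B b u)"
    and nrm_nonneg: "u \<in> carr B \<Longrightarrow> 0 \<le> nrm B u"
    and nrm_eq_0: "u \<in> carr B \<Longrightarrow> nrm B u = 0 \<longleftrightarrow> u = zer B"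
    and nrm_triangle: "u \<in> carr B \<Longrightarrow> v \<in> carr B \<Longrightarrow> nrm B (add B u v) \<le> nrm B u + nrm B v"
    and nrm_scl: "u \<in> carr B \<Longrightarrow> nrm B (scl B a u) = norm a * nrm B u"

locale Banach_space = Normed_space +
  assumes complete: "Metric_space.mcomplete (carr B) (ndist B)"

definition linear_operator :: "('k::real_normed_field, 'v) nspace \<Rightarrow> ('v \<Rightarrow> 'v) \<Rightarrow> bool" where
  "linear_operator B T \<longleftrightarrow>
     (\<forall>u\<in>carr B. T u \<in> carr B) \<and>
     (\<forall>u\<in>carr B. \<forall>v\<in>carr B. T (add B u v) = add B (T u) (T v)) \<and>
     (\<forall>a. \<forall>u\<in>carr B. T (scl B a u) = scl B a (T u))"

text \<open>Extended-real valued, so that the norm of an unbounded operator is \<open>\<infinity>\<close>.\<close>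

definition operator_norm :: "('k::real_normed_field, 'v) nspace \<Rightarrow> ('v \<Rightarrow> 'v) \<Rightarrow> ereal" where
  "operator_norm B T = (SUP u\<in>{u \<in> carr B. nrm B u \<le> 1}. ereal (nrm B (T u)))"

locale c0_one_parameter_group = Banach_space B
  for B :: "('k::real_normed_field, 'v) nspace" +
  fixes T :: "real \<Rightarrow> 'v \<Rightarrow> 'v"
  assumes linear: "linear_operator B (T t)"
    and jointly_continuous:
      "continuous_map (prod_topology euclideanreal (ntopology B)) (ntopology B) (\<lambda>(t, u). T t u)"
    and group_zero: "u \<in> carr B \<Longrightarrow> T 0 u = u"
    and group_add: "u \<in> carr B \<Longrightarrow> T t (T s u) = T (t + s) u"

lemma (in Normed_space) Metric_space_ndist: "Metric_space (carr B) (ndist B)"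
proof
  have neg: "add B v (scl B (- 1) u) = scl B (- 1) (add B u (scl B (- 1) v))"
    if "u \<in> carr B" "v \<in> carr B" for u v
    using that by (simp add: scl_add_right scl_closed scl_scl scl_one add_commute)
  show "0 \<le> ndist B u v" for u v
    by (simp add: ndist_def nrm_nonneg add_closed scl_closed)
  show "ndist B u v = ndist B v u" for u v
    by (auto simp: ndist_def neg[of u v] nrm_scl add_closed scl_closed)
  have cancel: "add B (add B u (scl B (- 1) v)) v = u" if "u \<in> carr B" "v \<in> carr B" for u v
  proof -
    have "add B (scl B (- 1) v) v = zer B"
      using that by (metis add_commute add_uminus scl_closed)
    then show ?thesis
      using that by (simp add: add_assoc scl_closed add_zer)
  qed
  show "ndist B u v = 0 \<longleftrightarrow> u = v" if "u \<in> carr B" "v \<in> carr B" for u v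
  proof
    assume "ndist B u v = 0"
    then have "add B u (scl B (- 1) v) = zer B"
      using that by (simp add: ndist_def nrm_eq_0 add_closed scl_closed)
    then show "u = v"
      using cancel[OF that] that by (metis add_commute add_zer zer_closed)
  next
    assume "u = v"
    then show "ndist B u v = 0"
      using that by (simp add: ndist_def add_uminus nrm_eq_0 zer_closed)
  qed
  show "ndist B u w \<le> ndist B u v + ndist B v w"
    if "u \<in> carr B" "v \<in> carr B" "w \<in> carr B" for u v w
  proof -
    have "add B u (scl B (- 1) w) = add B (add B u (scl B (- 1) v)) (add B v (scl B (- 1) w))"
      using cancel[OF that(1,2)] that by (metis add_assoc add_closed scl_closed)
    then show ?thesis
      using that by (simp add: ndist_def nrm_triangle add_closed scl_closed)
  qed
qed


section \<open>The Banach space \<open>L\<^sup>1\<close>\<close>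

definition l1_rel :: "'a measure \<Rightarrow> (('a \<Rightarrow> 'b::{real_normed_field, banach, second_countable_topology}) \<times> ('a \<Rightarrow> 'b)) set" where
  "l1_rel M = {(f, g). integrable M f \<and> integrable M g \<and> (AE x in M. f x = g x)}"

definition l1_class :: "'a measure \<Rightarrow> ('a \<Rightarrow> 'b) \<Rightarrow> ('a \<Rightarrow> 'b::{real_normed_field, banach, second_countable_topology}) set" where
  "l1_class M f = l1_rel M `` {f}"

definition L1 :: "'a measure \<Rightarrow> ('b, ('a \<Rightarrow> 'b::{real_normed_field, banach, second_countable_topology}) set) nspace" where
  "L1 M = \<lparr>
     carr = {f. integrable M f} // l1_rel M,
     add = (\<lambda>F G. \<Union>f\<in>F. \<Union>g\<in>G. l1_class M (\<lambda>x. f x + g x)),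
     zer = l1_class M (\<lambda>_. 0),
     scl = (\<lambda>a F. \<Union>f\<in>F. l1_class M (\<lambda>x. a * f x)),
     nrm = (\<lambda>F. the_elem ((\<lambda>f. LINT x|M. norm (f x)) ` F)) \<rparr>"

lemma equiv_l1_rel: "equiv {f. integrable M f} (l1_rel M)"
proof (rule equivI)
  show "l1_rel M \<subseteq> {f. integrable M f} \<times> {f. integrable M f}"
    by (auto simp: l1_rel_def)
  show "refl_on {f. integrable M f} (l1_rel M)"
    by (auto simp: refl_on_def l1_rel_def)
  show "sym (l1_rel M)"
    by (auto simp: sym_def l1_rel_def eq_commute)
  show "trans (l1_rel M)"
    unfolding trans_def l1_rel_def by (auto elim: eventually_elim2)
qed

lemma mem_l1_class:
  "g \<in> l1_class M f \<longleftrightarrow> integrable M f \<and> integrable M g \<and> (AE x in M. f x = g x)"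
  by (simp add: l1_class_def l1_rel_def)

lemma l1_class_self: "integrable M f \<Longrightarrow> f \<in> l1_class M f"
  by (simp add: mem_l1_class)

lemma l1_class_eq_iff:
  "integrable M f \<Longrightarrow> integrable M g \<Longrightarrow> l1_class M f = l1_class M g \<longleftrightarrow> (AE x in M. f x = g x)"
  unfolding l1_class_def by (subst eq_equiv_class_iff[OF equiv_l1_rel]) (auto simp: l1_rel_def)

lemma carr_L1: "carr (L1 M) = l1_class M ` {f. integrable M f}"
  by (auto simp: L1_def quotient_def l1_class_def)

lemma zer_L1: "zer (L1 M) = l1_class M (\<lambda>_. 0)"
  by (simp add: L1_def)

lemma add_L1:
  assumes "integrable M f" "integrable M g"
  shows "add (L1 M) (l1_class M f) (l1_class M g) = l1_class M (\<lambda>x. f x + g x)"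
proof -
  have *: "l1_class M (\<lambda>x. f' x + g' x) = l1_class M (\<lambda>x. f x + g x)"
    if "f' \<in> l1_class M f" "g' \<in> l1_class M g" for f' g'
    using that by (subst l1_class_eq_iff) (auto simp: mem_l1_class)
  have "(\<Union>f'\<in>l1_class M f. \<Union>g'\<in>l1_class M g. l1_class M (\<lambda>x. f' x + g' x)) =
      l1_class M (\<lambda>x. f x + g x)"
    by (intro UN_constant_eq[OF l1_class_self] ballI assms *)
  then show ?thesis
    by (simp add: L1_def)
qed

lemma scl_L1:
  assumes "integrable M f"
  shows "scl (L1 M) a (l1_class M f) = l1_class M (\<lambda>x. a * f x)"
proof -
  have *: "l1_class M (\<lambda>x. a * f' x) = l1_class M (\<lambda>x. a * f x)" if "f' \<in> l1_class M f" for f'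
  proof -
    from that have "AE x in M. f x = f' x"
      by (simp add: mem_l1_class)
    then have "AE x in M. a * f' x = a * f x"
      by eventually_elim simp
    then show ?thesis
      using that by (subst l1_class_eq_iff) (auto simp: mem_l1_class)
  qed
  have "(\<Union>f'\<in>l1_class M f. l1_class M (\<lambda>x. a * f' x)) = l1_class M (\<lambda>x. a * f x)"
    by (intro UN_constant_eq[OF l1_class_self] ballI assms *)
  then show ?thesis
    by (simp add: L1_def)
qed

lemma nrm_L1:
  assumes "integrable M f"
  shows "nrm (L1 M) (l1_class M f) = (LINT x|M. norm (f x))"
proof -
  have "(LINT x|M. norm (f' x)) = (LINT x|M. norm (f x))" if "f' \<in> l1_class M f" for f'
    using that by (intro integral_cong_AE) (auto simp: mem_l1_class)
  then have "(\<lambda>f. LINT x|M. norm (f x)) ` l1_class M f = {LINT x|M. norm (f x)}"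
    using l1_class_self[OF assms] by blast
  then show ?thesis
    by (simp add: L1_def)
qed

lemma ndist_L1:
  assumes "integrable M f" "integrable M g"
  shows "ndist (L1 M) (l1_class M f) (l1_class M g) = (LINT x|M. norm (f x - g x))"
  using assms by (auto simp: ndist_def carr_L1 scl_L1 add_L1 nrm_L1)

lemma Normed_space_L1:
  fixes M :: "'a measure"
  defines "B \<equiv> L1 M :: ('b::{real_normed_field, banach, second_countable_topology}, ('a \<Rightarrow> 'b) set) nspace"
  shows "Normed_space B"
proof
  fix u v w :: "('a \<Rightarrow> 'b) set" and a b :: 'b
  show "zer B \<in> carr B"
    by (auto simp: B_def carr_L1 zer_L1)
  assume "u \<in> carr B"
  then obtain f where f: "integrable M f" and u: "u = l1_class M f"
    by (auto simp: B_def carr_L1)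
  show "scl B a u \<in> carr B"
    using f by (auto simp: B_def u scl_L1 carr_L1)
  show "add B u (zer B) = u"
    using f by (simp add: B_def u zer_L1 add_L1)
  show "add B u (scl B (- 1) u) = zer B"
    using f by (simp add: B_def u zer_L1 add_L1 scl_L1)
  show "scl B a (scl B b u) = scl B (a * b) u"
    using f by (simp add: B_def u scl_L1 mult.assoc)
  show "scl B 1 u = u"
    using f by (simp add: B_def u scl_L1)
  show "scl B (a + b) u = add B (scl B a u) (scl B b u)"
    using f by (simp add: B_def u scl_L1 add_L1 distrib_right)
  show "0 \<le> nrm B u"
    using f by (simp add: B_def u nrm_L1)
  show "nrm B u = 0 \<longleftrightarrow> u = zer B"
    using f by (simp add: B_def u nrm_L1 zer_L1 l1_class_eq_iff integral_nonneg_eq_0_iff_AE)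
  show "nrm B (scl B a u) = norm a * nrm B u"
    using f by (simp add: B_def u scl_L1 nrm_L1 norm_mult)
  assume "v \<in> carr B"
  then obtain g where g: "integrable M g" and v: "v = l1_class M g"
    by (auto simp: B_def carr_L1)
  show "add B u v \<in> carr B"
    using f g by (auto simp: B_def u v add_L1 carr_L1)
  show "add B u v = add B v u"
    using f g by (simp add: B_def u v add_L1 add.commute)
  show "scl B a (add B u v) = add B (scl B a u) (scl B a v)"
    using f g by (simp add: B_def u v scl_L1 add_L1 distrib_left)
  have "(LINT x|M. norm (f x + g x)) \<le> (LINT x|M. norm (f x) + norm (g x))"
    using f g by (intro integral_mono) (auto intro: norm_triangle_ineq)
  then show "nrm B (add B u v) \<le> nrm B u + nrm B v"
    using f g by (simp add: B_def u v nrm_L1 add_L1)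
  assume "w \<in> carr B"
  then obtain h where h: "integrable M h" and w: "w = l1_class M h"
    by (auto simp: B_def carr_L1)
  show "add B (add B u v) w = add B u (add B v w)"
    using f g h by (simp add: B_def u v w add_L1 add.assoc)
qed

lemma L1_limit_exists:
  fixes s :: "nat \<Rightarrow> 'a \<Rightarrow> 'b::{banach, second_countable_topology}"
  assumes s[measurable]: "\<And>n. integrable M (s n)"
    and cau: "\<And>e. e > 0 \<Longrightarrow> \<exists>N. \<forall>i\<ge>N. \<forall>j\<ge>N. (LINT x|M. norm (s i x - s j x)) < e"
  obtains r h where "strict_mono r" "integrable M h"
    "(\<lambda>n. LINT x|M. norm (s (r n) x - h x)) \<longlonglongrightarrow> 0"
proof -
  obtain r where r: "strict_mono r" "AE x in M. Cauchy (\<lambda>i. s (r i) x)"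
    using cauchy_L1_AE_cauchy_subseq[OF assms] by blast
  define h where "h x = lim (\<lambda>i. s (r i) x)" for x
  have [measurable]: "s n \<in> borel_measurable M" for n
    using s by (rule borel_measurable_integrable)
  have [measurable]: "h \<in> borel_measurable M"
    unfolding h_def by measurable
  have lim: "AE x in M. (\<lambda>i. s (r i) x) \<longlonglongrightarrow> h x"
    using r(2) by eventually_elim (simp add: h_def Cauchy_convergent_iff convergent_LIMSEQ_iff)
  have fatou: "(\<integral>\<^sup>+x. norm (s i x - h x) \<partial>M) \<le> ennreal e"
    if N: "\<And>j. j \<ge> N \<Longrightarrow> (LINT x|M. norm (s i x - s j x)) < e" for i N e
  proof -
    have "(\<integral>\<^sup>+x. norm (s i x - h x) \<partial>M) = (\<integral>\<^sup>+x. liminf (\<lambda>n. ennreal (norm (s i x - s (r n) x))) \<partial>M)"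
    proof (rule nn_integral_cong_AE)
      show "AE x in M. ennreal (norm (s i x - h x)) = liminf (\<lambda>n. ennreal (norm (s i x - s (r n) x)))"
        using lim
      proof eventually_elim
        case (elim x)
        then have "(\<lambda>n. ennreal (norm (s i x - s (r n) x))) \<longlonglongrightarrow> ennreal (norm (s i x - h x))"
          by (intro tendsto_intros)
        then show ?case
          by (rule lim_imp_Liminf[OF sequentially_bot, symmetric])
      qed
    qed
    also have "\<dots> \<le> liminf (\<lambda>n. \<integral>\<^sup>+x. norm (s i x - s (r n) x) \<partial>M)"
      by (rule nn_integral_liminf) measurable
    also have "\<dots> \<le> limsup (\<lambda>n. \<integral>\<^sup>+x. norm (s i x - s (r n) x) \<partial>M)"
      by (rule Liminf_le_Limsup) simp
    also have "\<dots> \<le> ennreal e"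
    proof (rule Limsup_bounded)
      show "\<forall>\<^sub>F n in sequentially. (\<integral>\<^sup>+x. norm (s i x - s (r n) x) \<partial>M) \<le> ennreal e"
        using eventually_ge_at_top[of N]
      proof eventually_elim
        case (elim n)
        then have "(LINT x|M. norm (s i x - s (r n) x)) < e"
          using N seq_suble[OF r(1), of n] by (meson order_trans)
        then show ?case
          using s by (subst nn_integral_eq_integral) (auto intro: ennreal_leI)
      qed
    qed
    finally show ?thesis .
  qed
  obtain N where N: "\<And>i j. i \<ge> N \<Longrightarrow> j \<ge> N \<Longrightarrow> (LINT x|M. norm (s i x - s j x)) < 1"
    using cau[of 1] by auto
  have "integrable M (\<lambda>x. s N x - h x)"
  proof (rule integrableI_bounded)
    have "(\<integral>\<^sup>+x. norm (s N x - h x) \<partial>M) \<le> ennreal 1"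
      using fatou[of N N 1] N by simp
    then show "(\<integral>\<^sup>+x. norm (s N x - h x) \<partial>M) < \<infinity>"
      by (rule order.strict_trans1) simp
  qed measurable
  then have "integrable M (\<lambda>x. s N x - (s N x - h x))"
    by (rule Bochner_Integration.integrable_diff[OF s])
  then have h: "integrable M h"
    by simp
  have "(\<lambda>n. LINT x|M. norm (s (r n) x - h x)) \<longlonglongrightarrow> 0"
  proof (rule LIMSEQ_I)
    fix e :: real assume "e > 0"
    then obtain N where N: "\<And>i j. i \<ge> N \<Longrightarrow> j \<ge> N \<Longrightarrow> (LINT x|M. norm (s i x - s j x)) < e / 2"
      using cau[of "e / 2"] by auto
    have "norm ((LINT x|M. norm (s (r n) x - h x)) - 0) < e" if "n \<ge> N" for n
    proof -
      have "r n \<ge> N"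
        using that seq_suble[OF r(1), of n] by simp
      then have "(\<integral>\<^sup>+x. norm (s (r n) x - h x) \<partial>M) \<le> ennreal (e / 2)"
        using N by (intro fatou[of N]) auto
      then have "(LINT x|M. norm (s (r n) x - h x)) \<le> e / 2"
        using s h \<open>e > 0\<close> by (subst (asm) nn_integral_eq_integral) auto
      then show ?thesis
        using \<open>e > 0\<close> by simp
    qed
    then show "\<exists>N. \<forall>n\<ge>N. norm ((LINT x|M. norm (s (r n) x - h x)) - 0) < e"
      by blast
  qed
  with r(1) h show ?thesis
    by (rule that)
qed

theorem Banach_space_L1:
  fixes M :: "'a measure"
  defines "B \<equiv> L1 M :: ('b::{real_normed_field, banach, second_countable_topology}, ('a \<Rightarrow> 'b) set) nspace"
  shows "Banach_space B"
proof -
  interpret Normed_space B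
    unfolding B_def by (rule Normed_space_L1)
  interpret Metric_space "carr B" "ndist B"
    by (rule Metric_space_ndist)
  have "Metric_space.mcomplete (carr B) (ndist B)"
    unfolding mcomplete_def
  proof (intro allI impI)
    fix \<sigma> assume \<sigma>: "MCauchy \<sigma>"
    then have "\<sigma> n \<in> carr B" for n
      by (auto simp: MCauchy_def)
    then have "\<exists>f. integrable M f \<and> \<sigma> n = l1_class M f" for n
      by (auto simp: B_def carr_L1)
    then obtain s where s: "\<And>n. integrable M (s n)" and \<sigma>_eq: "\<And>n. \<sigma> n = l1_class M (s n)"
      by metis
    have "\<exists>N. \<forall>i\<ge>N. \<forall>j\<ge>N. (LINT x|M. norm (s i x - s j x)) < e" if "e > 0" for e
    proof -
      have "\<exists>N. \<forall>i j. N \<le> i \<longrightarrow> N \<le> j \<longrightarrow> ndist B (\<sigma> i) (\<sigma> j) < e"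
        using \<sigma> that by (simp add: MCauchy_def)
      then show ?thesis
        using s by (simp add: B_def \<sigma>_eq ndist_L1)
    qed
    with s obtain r h where r: "strict_mono r" and h: "integrable M h"
      and lim: "(\<lambda>n. LINT x|M. norm (s (r n) x - h x)) \<longlonglongrightarrow> 0"
      by (rule L1_limit_exists)
    have "limitin mtopology (\<sigma> \<circ> r) (l1_class M h) sequentially"
      unfolding limitin_metric_dist_null
      using lim s h by (simp add: B_def carr_L1 \<sigma>_eq ndist_L1)
    then show "\<exists>u. limitin mtopology \<sigma> u sequentially"
      using MCauchy_convergent_subsequence[OF \<sigma> r] by blast
  qed
  then show ?thesis
    by unfold_locales
qed


section \<open>Complete vector fields and their flow\<close>

text \<open>Vector fields on \<open>\<Omega>\<close> are total functions whose values off \<open>\<Omega>\<close> play no role.\<close>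

definition integral_curve ::
    "'a::real_normed_vector set \<Rightarrow> ('a \<Rightarrow> 'a) \<Rightarrow> 'a \<Rightarrow> (real \<Rightarrow> 'a) \<Rightarrow> bool" where
  "integral_curve \<Omega> X x c \<longleftrightarrow>
     c 0 = x \<and> (\<forall>t. c t \<in> \<Omega> \<and> (c has_vector_derivative X (c t)) (at t))"

definition complete_vector_field :: "'a::real_normed_vector set \<Rightarrow> ('a \<Rightarrow> 'a) \<Rightarrow> bool" where
  "complete_vector_field \<Omega> X \<longleftrightarrow> (\<forall>x\<in>\<Omega>. \<exists>c. integral_curve \<Omega> X x c)"

text \<open>
  \<open>flow \<Omega> X t x\<close> is \<open>\<gamma>\<^sup>X\<^sub>t(x)\<close>.  For a Lipschitz field the integral curve is unique
  (\<open>integral_curve_unique\<close> below), so the description is meaningful for all \<open>x \<in> \<Omega>\<close>.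
\<close>

definition flow :: "'a::real_normed_vector set \<Rightarrow> ('a \<Rightarrow> 'a) \<Rightarrow> real \<Rightarrow> 'a \<Rightarrow> 'a" where
  "flow \<Omega> X t x = (THE c. integral_curve \<Omega> X x c) t"

lemma integral_curve_unique_forward:
  fixes c d :: "real \<Rightarrow> 'a::real_inner"
  assumes L: "L-lipschitz_on \<Omega> X"
    and c: "\<And>t. c t \<in> \<Omega>" "\<And>t. (c has_vector_derivative X (c t)) (at t)"
    and d: "\<And>t. d t \<in> \<Omega>" "\<And>t. (d has_vector_derivative X (d t)) (at t)"
    and "c 0 = d 0" "0 \<le> t"
  shows "c t = d t"
proof -
  define q where "q t = (c t - d t) \<bullet> (c t - d t)" for t
  define p where "p t = (c t - d t) \<bullet> (X (c t) - X (d t))" for t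
  define u where "u t = exp (- 2 * L * t) * q t" for t
  define u' where "u' t = exp (- 2 * L * t) * (2 * p t - 2 * L * q t)" for t
  have u': "(u has_real_derivative u' t) (at t)" for t
  proof -
    have "((\<lambda>t. c t - d t) has_vector_derivative (X (c t) - X (d t))) (at t)"
      by (intro has_vector_derivative_diff c d)
    then have w: "((\<lambda>t. c t - d t) has_derivative (\<lambda>h. h *\<^sub>R (X (c t) - X (d t)))) (at t)"
      by (simp add: has_vector_derivative_def)
    have "(q has_derivative (\<lambda>h. (c t - d t) \<bullet> (h *\<^sub>R (X (c t) - X (d t))) +
        (h *\<^sub>R (X (c t) - X (d t))) \<bullet> (c t - d t))) (at t)"
      unfolding q_def[abs_def] by (rule has_derivative_inner[OF w w])
    also have "(\<lambda>h. (c t - d t) \<bullet> (h *\<^sub>R (X (c t) - X (d t))) +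
        (h *\<^sub>R (X (c t) - X (d t))) \<bullet> (c t - d t)) = (*) (2 * p t)"
      by (simp add: fun_eq_iff p_def inner_commute[of "X (c t) - X (d t)"] del: inner_diff_left inner_diff_right)
    finally have q: "(q has_real_derivative 2 * p t) (at t)"
      by (simp add: has_field_derivative_def)
    show ?thesis
      unfolding u_def[abs_def] u'_def
      by (rule derivative_eq_intros q refl | simp add: algebra_simps)+
  qed
  have neg: "u' t \<le> 0" for t
  proof -
    have "(c t - d t) \<bullet> (X (c t) - X (d t)) \<le> norm (c t - d t) * norm (X (c t) - X (d t))"
      by (rule norm_cauchy_schwarz)
    also have "\<dots> \<le> norm (c t - d t) * (L * norm (c t - d t))"
      using lipschitz_onD[OF L c(1) d(1), of t t] by (intro mult_left_mono) (auto simp: dist_norm)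
    also have "\<dots> = L * ((c t - d t) \<bullet> (c t - d t))"
      by (simp add: dot_square_norm power2_eq_square)
    finally show ?thesis
      by (simp add: u'_def p_def q_def mult_nonneg_nonpos del: inner_diff_left inner_diff_right)
  qed
  have "u t \<le> u 0"
  proof (rule DERIV_nonpos_imp_nonincreasing[OF \<open>0 \<le> t\<close>])
    show "\<exists>y. (u has_real_derivative y) (at s) \<and> y \<le> 0" for s
      by (rule exI[of _ "u' s"]) (rule conjI[OF u' neg])
  qed
  then have "(c t - d t) \<bullet> (c t - d t) \<le> 0"
    using \<open>c 0 = d 0\<close> by (simp add: u_def q_def mult_le_0_iff)
  then have "c t - d t = 0"
    by (metis inner_eq_zero_iff inner_ge_zero order_antisym)
  then show ?thesis
    by simp
qed

lemma integral_curve_unique: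
  fixes c d :: "real \<Rightarrow> 'a::real_inner"
  assumes L: "L-lipschitz_on \<Omega> X" and c: "integral_curve \<Omega> X x c" and d: "integral_curve \<Omega> X x d"
  shows "c = d"
proof
  have refl: "((\<lambda>t. e (- t)) has_vector_derivative - X (e (- t))) (at t)"
    if "integral_curve \<Omega> X x e" for e t
  proof -
    have "(e has_vector_derivative X (e (- t))) (at (- t))"
      using that by (simp add: integral_curve_def)
    moreover have "(uminus has_vector_derivative - 1) (at t)"
      by (auto intro!: derivative_eq_intros)
    ultimately show ?thesis
      using vector_diff_chain_at[of uminus "- 1" t e] by (simp add: o_def)
  qed
  have L': "L-lipschitz_on \<Omega> (\<lambda>x. - X x)"
    using L by (simp add: lipschitz_on_minus)
  have c': "c 0 = x" "\<And>t. c t \<in> \<Omega>" "\<And>t. (c has_vector_derivative X (c t)) (at t)"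
    and d': "d 0 = x" "\<And>t. d t \<in> \<Omega>" "\<And>t. (d has_vector_derivative X (d t)) (at t)"
    using c d by (simp_all add: integral_curve_def)
  fix t
  show "c t = d t"
  proof (cases "0 \<le> t")
    case True
    then show ?thesis
      using integral_curve_unique_forward[OF L c'(2,3) d'(2,3)] c'(1) d'(1) by simp
  next
    case False
    have "c (- (- t)) = d (- (- t))"
      by (rule integral_curve_unique_forward[OF L' c'(2) refl[OF c] d'(2) refl[OF d]])
        (use c' d' False in simp_all)
    then show ?thesis
      by simp
  qed
qed

lemma integral_curve_flow:
  fixes X :: "'a::real_inner \<Rightarrow> 'a"
  assumes "L-lipschitz_on \<Omega> X" "complete_vector_field \<Omega> X" "x \<in> \<Omega>"
  shows "integral_curve \<Omega> X x (\<lambda>t. flow \<Omega> X t x)"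
proof -
  have "\<exists>!c. integral_curve \<Omega> X x c"
    using assms integral_curve_unique[OF assms(1)] by (auto simp: complete_vector_field_def)
  from theI'[OF this] show ?thesis
    by (simp add: flow_def)
qed

text \<open>
  The class of \<open>f \<circ> \<gamma>\<^sup>X\<^sub>t\<close>, formed over all representatives \<open>f\<close> of \<open>F \<in> L\<^sup>1(\<Omega>)\<close>.  The union is
  a single element of \<open>L\<^sup>1(\<Omega>)\<close> only if the pulled-back functions are integrable and their class
  does not depend on the representative.
\<close>

definition flow_pullback ::
    "'a::euclidean_space set \<Rightarrow> ('a \<Rightarrow> 'a) \<Rightarrow> real \<Rightarrow>
     ('a \<Rightarrow> 'b::{real_normed_field, banach, second_countable_topology}) set \<Rightarrow> ('a \<Rightarrow> 'b) set" where
  "flow_pullback \<Omega> X t F = (\<Union>f\<in>F. l1_class (lebesgue_on \<Omega>) (f \<circ> flow \<Omega> X t))"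

end

theory Submission
  imports Defs
begin

text \<open>
  By Gronwall's inequality the flow map \<open>\<gamma>\<^sub>t\<close> is Lipschitz on \<open>\<Omega>\<close> with constant \<open>e\<^bsup>L|t|\<^esup>\<close>. Covering
  a set by small disjoint balls (Vitali) shows that a \<open>K\<close>-Lipschitz map of \<open>n\<close>-space increases
  Lebesgue measure at most by the factor \<open>K\<^sup>n\<close>. Since the preimage of a set under \<open>\<gamma>\<^sub>t\<close> is its image
  under \<open>\<gamma>\<^bsub>-t\<^esub>\<close>, the pullback has norm at most \<open>e\<^bsup>nL|t|\<^esup>\<close> on \<open>L\<^sup>1(\<Omega>)\<close>. With this bound, joint continuity
  reduces to strong continuity at \<open>t = 0\<close>, which only needs checking on a set with dense span, namely
  the indicators of open sets of finite measure.
\<close>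

section \<open>Measure of Lipschitz images\<close>

text \<open>Countable subadditivity over an index set of any type, here pairs of a centre and a
  radius, with the sum written as an integral over \<open>count_space\<close>. The indicator of the
  union is at most the sum of the indicators, and sum and integral may be interchanged.\<close>

lemma emeasure_UN_le_nn_integral:
  assumes "countable I" and X: "\<And>i. i \<in> I \<Longrightarrow> X i \<in> sets M"
  shows "emeasure M (\<Union>i\<in>I. X i) \<le> (\<integral>\<^sup>+i. emeasure M (X i) \<partial>count_space I)"
proof -
  have "emeasure M (\<Union>i\<in>I. X i) = (\<integral>\<^sup>+x. indicator (\<Union>i\<in>I. X i) x \<partial>M)"
    using assms by (intro nn_integral_indicator[symmetric] sets.countable_UN') auto
  also have "\<dots> \<le> (\<integral>\<^sup>+x. (\<integral>\<^sup>+i. indicator (X i) x \<partial>count_space I) \<partial>M)"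
  proof (rule nn_integral_mono)
    fix x
    have "(1 :: ennreal) \<le> (\<integral>\<^sup>+i. indicator (X i) x \<partial>count_space I)" if "j \<in> I" "x \<in> X j" for j
    proof -
      have "1 = (\<integral>\<^sup>+i. indicator {j} i \<partial>count_space I)"
        using that by simp
      also have "\<dots> \<le> (\<integral>\<^sup>+i. indicator (X i) x \<partial>count_space I)"
        using that by (intro nn_integral_mono) (auto split: split_indicator)
      finally show ?thesis .
    qed
    then show "indicator (\<Union>i\<in>I. X i) x \<le> (\<integral>\<^sup>+i. indicator (X i) x \<partial>count_space I)"
      by (auto split: split_indicator)
  qed
  also have "\<dots> = (\<integral>\<^sup>+i. (\<integral>\<^sup>+x. indicator (X i) x \<partial>M) \<partial>count_space I)"
    using assms by (intro nn_integral_count_space_nn_integral) auto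
  also have "\<dots> = (\<integral>\<^sup>+i. emeasure M (X i) \<partial>count_space I)"
    using X by (intro nn_integral_cong) simp
  finally show ?thesis .
qed

lemma negligible_lipschitz_image:
  fixes f :: "'a::euclidean_space \<Rightarrow> 'a"
  assumes f: "K-lipschitz_on S f" and "negligible N" "N \<subseteq> S"
  shows "negligible (f ` N)"
proof (rule negligible_locally_Lipschitz_image)
  show "\<exists>T B. open T \<and> x \<in> T \<and> (\<forall>y\<in>N \<inter> T. norm (f y - f x) \<le> B * norm (y - x))" if "x \<in> N" for x
    using that lipschitz_onD[OF f] \<open>N \<subseteq> S\<close>
    by (intro exI[of _ UNIV] exI[of _ K]) (auto simp: dist_norm subset_iff)
qed (use assms in auto)

text \<open>Up to a null set, a Lebesgue set is a countable union of compact sets. Continuity keeps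
  these compact, and the Lipschitz bound keeps the null set null.\<close>

lemma lipschitz_image_sets_lebesgue:
  fixes f :: "'a::euclidean_space \<Rightarrow> 'a"
  assumes "K-lipschitz_on S f" "A \<in> sets lebesgue" "A \<subseteq> S"
  shows "f ` A \<in> sets lebesgue"
  by (rule sets_lebesgue_continuous_image[where S = S])
    (use assms negligible_lipschitz_image lipschitz_on_continuous_on in blast)+

text \<open>Vitali gives disjoint balls inside \<open>T\<close>, centred in \<open>S\<close>, that
  cover \<open>S\<close> up to a null set. The part of \<open>S\<close> in a ball of radius
  \<open>r\<close> is mapped into the ball of radius \<open>K * r\<close> about the image of the
  centre, whose measure is larger by the factor \<open>K ^ DIM('a)\<close>. The new balls may
  overlap, so they are only summed; the old ones are disjoint, so their sum is the measure of a
  subset of \<open>T\<close>.\<close>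

lemma emeasure_lipschitz_image_le_open:
  fixes f :: "'a::euclidean_space \<Rightarrow> 'a"
  assumes f: "K-lipschitz_on S f" and S: "S \<in> sets lebesgue" and T: "open T" "S \<subseteq> T"
  shows "emeasure lebesgue (f ` S) \<le> ennreal (K ^ DIM('a)) * emeasure lebesgue T"
proof -
  have "K \<ge> 0"
    using f by (rule lipschitz_on_nonneg)
  define I where "I = {(x, r) |x r. x \<in> S \<and> 0 < r \<and> cball x r \<subseteq> T}"
  have cover: "\<exists>i. i \<in> I \<and> x \<in> cball (fst i) (snd i) \<and> snd i < d" if "x \<in> S" "0 < d" for x d
  proof -
    obtain e where e: "e > 0" "cball x e \<subseteq> T"
      using T \<open>x \<in> S\<close> by (meson open_contains_cball subsetD)
    \<comment> \<open>The bound \<open>e\<close> keeps the ball inside \<open>T\<close>, and halving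
      \<open>d\<close> makes the radius strictly smaller than \<open>d\<close>.\<close>
    have "cball x (min e (d / 2)) \<subseteq> cball x e"
      by (rule subset_cball) simp
    then show ?thesis
      using e that by (intro exI[of _ "(x, min e (d / 2))"]) (auto simp: I_def min_def)
  qed
  have pos: "0 < snd i" if "i \<in> I" for i
    using that by (auto simp: I_def)
  obtain C where C: "countable C" "C \<subseteq> I"
    and disj: "pairwise (\<lambda>i j. disjnt (cball (fst i) (snd i)) (cball (fst j) (snd j))) C"
    and neg: "negligible (S - (\<Union>i\<in>C. cball (fst i) (snd i)))"
    by (rule Vitali_covering_theorem_cballs[of I snd S fst, OF pos cover])
  \<comment> \<open>The points missed by the balls are dealt with separately: their image is
    null.\<close>
  define N where "N = f ` (S - (\<Union>i\<in>C. cball (fst i) (snd i)))"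
  define D where "D = (\<lambda>i. cball (f (fst i)) (K * snd i))"
  have CI: "fst i \<in> S" "0 < snd i" "cball (fst i) (snd i) \<subseteq> T" if "i \<in> C" for i
    using subsetD[OF \<open>C \<subseteq> I\<close> that] by (auto simp: I_def simp del: mem_cball)
  have "negligible N"
    unfolding N_def using f neg by (rule negligible_lipschitz_image) blast
  then have N: "N \<in> null_sets lebesgue"
    by (simp add: negligible_iff_null_sets)
  have D: "(\<Union>i\<in>C. D i) \<in> sets lebesgue"
    using \<open>countable C\<close> by (intro sets.countable_UN') (auto simp: D_def)
  have sub: "f ` S \<subseteq> (\<Union>i\<in>C. D i) \<union> N"
  proof clarsimp
    fix x assume x: "x \<in> S" "f x \<notin> N"
    then obtain i where i: "i \<in> C" "x \<in> cball (fst i) (snd i)"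
      unfolding N_def by blast
    have "dist (f (fst i)) (f x) \<le> K * dist (fst i) x"
      using f CI(1)[OF i(1)] x(1) by (rule lipschitz_onD)
    also have "\<dots> \<le> K * snd i"
      using i(2) \<open>K \<ge> 0\<close> by (intro mult_left_mono) auto
    finally show "\<exists>i\<in>C. f x \<in> D i"
      using i(1) by (auto simp: D_def)
  qed
  have "emeasure lebesgue (f ` S) \<le> emeasure lebesgue ((\<Union>i\<in>C. D i) \<union> N)"
    using sub D N by (intro emeasure_mono) auto
  also have "\<dots> = emeasure lebesgue (\<Union>i\<in>C. D i)"
    using D N by (intro emeasure_Un_null_set)
  also have "\<dots> \<le> (\<integral>\<^sup>+i. emeasure lebesgue (D i) \<partial>count_space C)"
    using \<open>countable C\<close> by (intro emeasure_UN_le_nn_integral) (auto simp: D_def)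
  also have "\<dots> = (\<integral>\<^sup>+i. ennreal (K ^ DIM('a)) * emeasure lebesgue (cball (fst i) (snd i)) \<partial>count_space C)"
  proof (rule nn_integral_cong)
    fix i assume "i \<in> space (count_space C)"
    then have "0 < snd i"
      using CI by simp
    then show "emeasure lebesgue (D i) =
        ennreal (K ^ DIM('a)) * emeasure lebesgue (cball (fst i) (snd i))"
      using \<open>K \<ge> 0\<close>
      by (simp add: D_def emeasure_cball power_mult_distrib ennreal_mult'[symmetric] mult_ac)
  qed
  also have "\<dots> = ennreal (K ^ DIM('a)) * (\<integral>\<^sup>+i. emeasure lebesgue (cball (fst i) (snd i)) \<partial>count_space C)"
    by (simp add: nn_integral_cmult)
  also have "(\<integral>\<^sup>+i. emeasure lebesgue (cball (fst i) (snd i)) \<partial>count_space C) =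
      emeasure lebesgue (\<Union>i\<in>C. cball (fst i) (snd i))"
    using C disj by (intro emeasure_UN_countable[symmetric])
      (auto simp: disjoint_family_on_def pairwise_def disjnt_def)
  also have "ennreal (K ^ DIM('a)) * \<dots> \<le> ennreal (K ^ DIM('a)) * emeasure lebesgue T"
    using CI(3) T by (intro mult_left_mono emeasure_mono UN_least) auto
  finally show ?thesis .
qed

text \<open>Outer regularity: the open set of the previous estimate can be chosen with measure
  arbitrarily close to that of \<open>S\<close>.\<close>

lemma emeasure_lipschitz_image_le:
  fixes f :: "'a::euclidean_space \<Rightarrow> 'a"
  assumes f: "K-lipschitz_on S f" and S: "S \<in> sets lebesgue"
  shows "emeasure lebesgue (f ` S) \<le> ennreal (K ^ DIM('a)) * emeasure lebesgue S"
proof (rule ennreal_le_epsilon)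
  fix e :: real assume "0 < e"
  have K: "0 \<le> K ^ DIM('a)"
    using f by (simp add: lipschitz_on_nonneg)
  \<comment> \<open>Chosen so that \<open>K ^ DIM('a) * d \<le> e\<close>; the summand 1 avoids a
    division by zero when \<open>K = 0\<close>.\<close>
  define d where "d = e / (K ^ DIM('a) + 1)"
  have "0 < d"
    using \<open>0 < e\<close> K by (simp add: d_def)
  then obtain T where T: "open T" "S \<subseteq> T" "T - S \<in> lmeasurable" "emeasure lebesgue (T - S) < ennreal d"
    by (rule sets_lebesgue_outer_open[OF S])
  have "emeasure lebesgue T = emeasure lebesgue S + emeasure lebesgue (T - S)"
    using S T by (subst plus_emeasure) (auto simp: Un_absorb1)
  also have "\<dots> \<le> emeasure lebesgue S + ennreal d"
    using T(4) by (intro add_left_mono) simp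
  finally have T_le: "emeasure lebesgue T \<le> emeasure lebesgue S + ennreal d" .
  have "emeasure lebesgue (f ` S) \<le> ennreal (K ^ DIM('a)) * emeasure lebesgue T"
    using f S T(1,2) by (rule emeasure_lipschitz_image_le_open)
  also have "\<dots> \<le> ennreal (K ^ DIM('a)) * (emeasure lebesgue S + ennreal d)"
    using T_le by (rule mult_left_mono) simp
  also have "\<dots> = ennreal (K ^ DIM('a)) * emeasure lebesgue S + ennreal (K ^ DIM('a) * d)"
    using K \<open>0 < d\<close> by (simp add: distrib_left ennreal_mult)
  also have "ennreal (K ^ DIM('a) * d) \<le> ennreal e"
    using K \<open>0 < e\<close> by (intro ennreal_leI) (simp add: d_def field_simps)
  finally show "emeasure lebesgue (f ` S) \<le> ennreal (K ^ DIM('a)) * emeasure lebesgue S + ennreal e"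
    by (simp add: add_left_mono)
qed

text \<open>The hypothesis on sets says that the image measure \<open>distr M N T\<close> lies below
  \<open>c\<close> times \<open>N\<close>, and the integral is monotone in the measure. This
  replaces a change of variables formula by an inequality that involves no Jacobian.\<close>

lemma nn_integral_compose_le:
  assumes T[measurable]: "T \<in> measurable M N"
    and le: "\<And>A. A \<in> sets N \<Longrightarrow> emeasure M (T -` A \<inter> space M) \<le> c * emeasure N A"
    and g[measurable]: "g \<in> borel_measurable N"
  shows "(\<integral>\<^sup>+x. g (T x) \<partial>M) \<le> c * (\<integral>\<^sup>+x. g x \<partial>N)"
proof -
  have "(\<integral>\<^sup>+x. g (T x) \<partial>M) = (\<integral>\<^sup>+x. g x \<partial>distr M N T)"
    by (simp add: nn_integral_distr)
  also have "\<dots> \<le> (\<integral>\<^sup>+x. g x \<partial>density N (\<lambda>_. c))"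
  proof (rule nn_integral_mono_measure)
    have "emeasure (distr M N T) A \<le> emeasure (density N (\<lambda>_. c)) A" for A
    proof (cases "A \<in> sets N")
      case True
      then show ?thesis
        using le by (simp add: emeasure_distr emeasure_density nn_integral_cmult_indicator)
    next
      case False
      then show ?thesis
        by (simp add: emeasure_notin_sets)
    qed
    then show "distr M N T \<le> density N (\<lambda>_. c)"
      by (simp add: le_measure_iff le_fun_def)
  qed simp
  also have "\<dots> = c * (\<integral>\<^sup>+x. g x \<partial>N)"
    by (simp add: nn_integral_density nn_integral_cmult)
  finally show ?thesis .
qed

section \<open>Dependence of integral curves on the initial value\<close>

text \<open>Gronwall for the squared distance \<open>q\<close>, which unlike the distance is
  differentiable everywhere: Cauchy-Schwarz and the Lipschitz bound give
  \<open>q' \<le> 2 * L * q\<close>, so \<open>exp (- 2 * L * t) * q t\<close> does not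
  increase.\<close>

lemma integral_curve_dist_le_forward:
  fixes c d :: "real \<Rightarrow> 'a::real_inner"
  assumes L: "L-lipschitz_on \<Omega> X"
    and c: "integral_curve \<Omega> X x c" and d: "integral_curve \<Omega> X y d" and "0 \<le> t"
  shows "dist (c t) (d t) \<le> exp (L * t) * dist x y"
proof -
  have c': "c 0 = x" "\<And>t. c t \<in> \<Omega>" "\<And>t. (c has_vector_derivative X (c t)) (at t)"
    and d': "d 0 = y" "\<And>t. d t \<in> \<Omega>" "\<And>t. (d has_vector_derivative X (d t)) (at t)"
    using c d by (simp_all add: integral_curve_def)
  define q where "q t = (c t - d t) \<bullet> (c t - d t)" for t
  define p where "p t = (c t - d t) \<bullet> (X (c t) - X (d t))" for t
  define u where "u t = exp (- 2 * L * t) * q t" for t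
  have u: "(u has_real_derivative exp (- 2 * L * t) * (2 * p t - 2 * L * q t)) (at t)" for t
  proof -
    have w: "((\<lambda>t. c t - d t) has_derivative (\<lambda>h. h *\<^sub>R (X (c t) - X (d t)))) (at t)"
      using has_vector_derivative_diff[OF c'(3) d'(3)] by (simp add: has_vector_derivative_def)
    have "(q has_derivative (\<lambda>h. (c t - d t) \<bullet> (h *\<^sub>R (X (c t) - X (d t))) +
        (h *\<^sub>R (X (c t) - X (d t))) \<bullet> (c t - d t))) (at t)"
      unfolding q_def[abs_def] by (rule has_derivative_inner[OF w w])
    also have "(\<lambda>h. (c t - d t) \<bullet> (h *\<^sub>R (X (c t) - X (d t))) +
        (h *\<^sub>R (X (c t) - X (d t))) \<bullet> (c t - d t)) = (*) (2 * p t)"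
      by (simp add: fun_eq_iff p_def inner_commute[of "X (c t) - X (d t)"]
          del: inner_diff_left inner_diff_right)
    finally have q: "(q has_real_derivative 2 * p t) (at t)"
      by (simp add: has_field_derivative_def)
    show ?thesis
      unfolding u_def[abs_def] by (rule derivative_eq_intros q refl | simp add: algebra_simps)+
  qed
  have "p t \<le> L * q t" for t
  proof -
    have "p t \<le> norm (c t - d t) * norm (X (c t) - X (d t))"
      unfolding p_def by (rule norm_cauchy_schwarz)
    also have "\<dots> \<le> norm (c t - d t) * (L * norm (c t - d t))"
      using lipschitz_onD[OF L c'(2) d'(2), of t t] by (intro mult_left_mono) (auto simp: dist_norm)
    also have "\<dots> = L * q t"
      by (simp add: q_def dot_square_norm power2_eq_square)
    finally show ?thesis .
  qed
  then have "exp (- 2 * L * t) * (2 * p t - 2 * L * q t) \<le> 0" for t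
    by (simp add: mult_nonneg_nonpos mult.assoc)
  then have "u t \<le> u 0"
    using u by (intro DERIV_nonpos_imp_nonincreasing[OF \<open>0 \<le> t\<close>]) blast
  then have "q t \<le> exp (2 * L * t) * q 0"
    by (simp add: u_def exp_minus field_simps)
  then have "(dist (c t) (d t))\<^sup>2 \<le> (exp (L * t) * dist x y)\<^sup>2"
    using c'(1) d'(1)
    by (simp add: q_def dist_norm dot_square_norm power_mult_distrib exp_double[symmetric] mult.assoc)
  then show ?thesis
    by (rule power2_le_imp_le) simp
qed

text \<open>Reduces negative times to positive ones, because \<open>- X\<close> has the same
  Lipschitz constant as \<open>X\<close>.\<close>

lemma integral_curve_reverse:
  assumes "integral_curve \<Omega> X x c"
  shows "integral_curve \<Omega> (\<lambda>x. - X x) x (\<lambda>t. c (- t))"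
proof -
  have "((\<lambda>t. c (- t)) has_vector_derivative - X (c (- t))) (at t)" for t
  proof -
    have "(c has_vector_derivative X (c (- t))) (at (- t))"
      using assms by (simp add: integral_curve_def)
    moreover have "(uminus has_vector_derivative - 1) (at t)"
      by (auto intro!: derivative_eq_intros)
    ultimately show ?thesis
      using vector_diff_chain_at[of uminus "- 1" t c] by (simp add: o_def)
  qed
  then show ?thesis
    using assms by (simp add: integral_curve_def)
qed

text \<open>The field does not depend on time. Together with uniqueness this yields the group law of
  the flow.\<close>

lemma integral_curve_shift:
  assumes "integral_curve \<Omega> X x c"
  shows "integral_curve \<Omega> X (c s) (\<lambda>t. c (t + s))"
proof -
  have "((\<lambda>t. c (t + s)) has_vector_derivative X (c (t + s))) (at t)" for t
  proof -
    have "(c has_vector_derivative X (c (t + s))) (at (t + s))"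
      using assms by (simp add: integral_curve_def)
    moreover have "((\<lambda>t. t + s) has_vector_derivative 1) (at t)"
      by (auto intro!: derivative_eq_intros)
    ultimately show ?thesis
      using vector_diff_chain_at[of "\<lambda>t. t + s" 1 t c] by (simp add: o_def)
  qed
  then show ?thesis
    using assms by (simp add: integral_curve_def)
qed

lemma integral_curve_dist_le:
  fixes c d :: "real \<Rightarrow> 'a::real_inner"
  assumes L: "L-lipschitz_on \<Omega> X"
    and c: "integral_curve \<Omega> X x c" and d: "integral_curve \<Omega> X y d"
  shows "dist (c t) (d t) \<le> exp (L * \<bar>t\<bar>) * dist x y"
proof (cases "0 \<le> t")
  case True
  then show ?thesis
    using integral_curve_dist_le_forward[OF assms, of t] by simp
next
  case False
  have "L-lipschitz_on \<Omega> (\<lambda>x. - X x)"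
    using L by (simp add: lipschitz_on_minus)
  from integral_curve_dist_le_forward[OF this c[THEN integral_curve_reverse]
      d[THEN integral_curve_reverse], of "- t"] False
  show ?thesis
    by simp
qed

section \<open>The flow of a complete Lipschitz field\<close>

locale complete_lipschitz_field =
  fixes \<Omega> :: "'a::euclidean_space set" and X :: "'a \<Rightarrow> 'a" and L :: real
  assumes open_domain: "open \<Omega>"
    and lipschitz: "L-lipschitz_on \<Omega> X"
    and complete_field: "complete_vector_field \<Omega> X"
begin

abbreviation "\<gamma> \<equiv> flow \<Omega> X"
abbreviation "M \<equiv> lebesgue_on \<Omega>"

lemma L_nonneg: "0 \<le> L"
  using lipschitz by (rule lipschitz_on_nonneg)

lemma domain_sets [simp]: "\<Omega> \<in> sets lebesgue"
  using open_domain by simp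

lemma sets_M_iff: "A \<in> sets M \<longleftrightarrow> A \<subseteq> \<Omega> \<and> A \<in> sets lebesgue"
  by (simp add: sets_restrict_space_iff)

lemma flow_curve: "x \<in> \<Omega> \<Longrightarrow> integral_curve \<Omega> X x (\<lambda>t. \<gamma> t x)"
  by (rule integral_curve_flow[OF lipschitz complete_field])

lemma flow_zero: "x \<in> \<Omega> \<Longrightarrow> \<gamma> 0 x = x"
  and flow_closed: "x \<in> \<Omega> \<Longrightarrow> \<gamma> t x \<in> \<Omega>"
  using flow_curve[of x] by (simp_all add: integral_curve_def)

lemma continuous_flow_time:
  assumes "x \<in> \<Omega>"
  shows "isCont (\<lambda>t. \<gamma> t x) t"
proof -
  have "((\<lambda>t. \<gamma> t x) has_vector_derivative X (\<gamma> t x)) (at t)"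
    using flow_curve[OF assms] by (simp add: integral_curve_def)
  then show ?thesis
    by (rule has_vector_derivative_continuous)
qed

text \<open>As functions of \<open>t\<close>, both sides are integral curves starting at
  \<open>\<gamma> s x\<close>.\<close>

lemma flow_add:
  assumes "x \<in> \<Omega>"
  shows "\<gamma> t (\<gamma> s x) = \<gamma> (t + s) x"
  using integral_curve_unique[OF lipschitz flow_curve[OF flow_closed[OF assms]]
      integral_curve_shift[OF flow_curve[OF assms]], of s]
  by (rule fun_cong)

lemma lipschitz_flow: "(exp (L * \<bar>t\<bar>))-lipschitz_on \<Omega> (\<gamma> t)"
  by (rule lipschitz_onI) (use integral_curve_dist_le[OF lipschitz flow_curve flow_curve] in auto)

text \<open>On \<Omega> the maps \<open>\<gamma> t\<close> and \<open>\<gamma> (- t)\<close> are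
  inverse to each other. Preimages thus become images, to which the estimates for Lipschitz images
  apply.\<close>

lemma flow_vimage:
  assumes "A \<subseteq> \<Omega>"
  shows "\<gamma> t -` A \<inter> \<Omega> = \<gamma> (- t) ` A"
proof
  show "\<gamma> t -` A \<inter> \<Omega> \<subseteq> \<gamma> (- t) ` A"
  proof clarify
    fix x assume "\<gamma> t x \<in> A" "x \<in> \<Omega>"
    moreover from this have "\<gamma> (- t) (\<gamma> t x) = x"
      by (simp add: flow_add flow_zero)
    ultimately show "x \<in> \<gamma> (- t) ` A"
      by (metis imageI)
  qed
  show "\<gamma> (- t) ` A \<subseteq> \<gamma> t -` A \<inter> \<Omega>"
    using assms flow_add[of _ t "- t"] by (auto simp: flow_zero flow_closed subset_iff)
qed

section \<open>Measurability of the flow maps, distortion of measure and integral bounds\<close>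

text \<open>Continuity alone would only handle preimages of Borel sets. A preimage of a Lebesgue set
  is measurable here because it is a Lipschitz image under \<open>\<gamma> (- t)\<close>.\<close>

lemma measurable_flow [measurable]: "\<gamma> t \<in> measurable M M"
proof (rule measurableI)
  show "\<gamma> t -` A \<inter> space M \<in> sets M" if "A \<in> sets M" for A
  proof -
    have A: "A \<subseteq> \<Omega>" "A \<in> sets lebesgue"
      using that by (simp_all add: sets_M_iff)
    then show ?thesis
      using lipschitz_image_sets_lebesgue[OF lipschitz_flow A(2,1)]
      by (auto simp: sets_M_iff flow_vimage flow_closed)
  qed
qed (simp add: flow_closed)

lemma emeasure_flow_vimage_le:
  assumes "A \<in> sets M"
  shows "emeasure M (\<gamma> t -` A \<inter> space M) \<le> ennreal (exp (real DIM('a) * L * \<bar>t\<bar>)) * emeasure M A"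
proof -
  have A: "A \<subseteq> \<Omega>" "A \<in> sets lebesgue"
    using assms by (simp_all add: sets_M_iff)
  have "emeasure lebesgue (\<gamma> (- t) ` A) \<le> ennreal (exp (L * \<bar>- t\<bar>) ^ DIM('a)) * emeasure lebesgue A"
    using lipschitz_on_subset[OF lipschitz_flow A(1)] A(2) by (rule emeasure_lipschitz_image_le)
  moreover have "emeasure M (\<gamma> t -` A \<inter> space M) = emeasure lebesgue (\<gamma> (- t) ` A)"
    using A(1) flow_closed by (subst emeasure_restrict_space) (auto simp: flow_vimage)
  moreover have "emeasure M A = emeasure lebesgue A"
    using A(1) by (intro emeasure_restrict_space) auto
  \<comment> \<open>The dimension enters the exponent here, as the power of the Lipschitz constant
    of \<open>\<gamma> (- t)\<close>.\<close>
  moreover have "exp (L * \<bar>- t\<bar>) ^ DIM('a) = exp (real DIM('a) * L * \<bar>t\<bar>)"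
    by (simp add: exp_of_nat_mult[symmetric] mult_ac)
  ultimately show ?thesis
    by metis
qed

lemma nn_integral_flow_le:
  "g \<in> borel_measurable M \<Longrightarrow> (\<integral>\<^sup>+x. g (\<gamma> t x) \<partial>M) \<le> ennreal (exp (real DIM('a) * L * \<bar>t\<bar>)) * (\<integral>\<^sup>+x. g x \<partial>M)"
  by (rule nn_integral_compose_le[OF measurable_flow emeasure_flow_vimage_le])

lemma integrable_flow:
  fixes f :: "'a \<Rightarrow> 'b::{banach, second_countable_topology}"
  assumes f: "integrable M f"
  shows "integrable M (\<lambda>x. f (\<gamma> t x))"
proof (rule integrableI_bounded)
  have [measurable]: "f \<in> borel_measurable M"
    using f by simp
  show "(\<lambda>x. f (\<gamma> t x)) \<in> borel_measurable M"
    by measurable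
  have "(\<integral>\<^sup>+x. norm (f (\<gamma> t x)) \<partial>M) \<le> ennreal (exp (real DIM('a) * L * \<bar>t\<bar>)) * (\<integral>\<^sup>+x. norm (f x) \<partial>M)"
    by (rule nn_integral_flow_le) measurable
  also have "\<dots> < \<infinity>"
    using f by (simp add: integrable_iff_bounded ennreal_mult_less_top)
  finally show "(\<integral>\<^sup>+x. norm (f (\<gamma> t x)) \<partial>M) < \<infinity>" .
qed

text \<open>The measure bound makes preimages of null sets null. This is what lets composition with
  the flow act on classes modulo null sets.\<close>

lemma AE_flow: "AE x in M. P x \<Longrightarrow> AE x in M. P (\<gamma> t x)"
proof -
  assume "AE x in M. P x"
  then obtain N where N: "N \<in> null_sets M" "{x \<in> space M. \<not> P x} \<subseteq> N"
    by (auto simp: eventually_ae_filter)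
  have "\<gamma> t -` N \<inter> space M \<in> null_sets M"
    using N(1) emeasure_flow_vimage_le[of N t] measurable_sets[OF measurable_flow, of N t]
    by (auto simp: null_sets_def)
  then show ?thesis
    by (rule AE_I') (use N(2) flow_closed in auto)
qed

lemma integral_norm_flow_le:
  fixes f :: "'a \<Rightarrow> 'b::{banach, second_countable_topology}"
  assumes f: "integrable M f"
  shows "(LINT x|M. norm (f (\<gamma> t x))) \<le> exp (real DIM('a) * L * \<bar>t\<bar>) * (LINT x|M. norm (f x))"
proof -
  have [measurable]: "f \<in> borel_measurable M"
    using f by simp
  have "ennreal (LINT x|M. norm (f (\<gamma> t x))) = (\<integral>\<^sup>+x. norm (f (\<gamma> t x)) \<partial>M)"
    using integrable_flow[OF f] by (simp add: nn_integral_eq_integral)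
  also have "\<dots> \<le> ennreal (exp (real DIM('a) * L * \<bar>t\<bar>)) * (\<integral>\<^sup>+x. norm (f x) \<partial>M)"
    by (rule nn_integral_flow_le) measurable
  also have "\<dots> = ennreal (exp (real DIM('a) * L * \<bar>t\<bar>) * (LINT x|M. norm (f x)))"
    using f by (simp add: nn_integral_eq_integral ennreal_mult)
  finally show ?thesis
    by (simp add: ennreal_le_iff)
qed

subsection \<open>Strong continuity\<close>

text \<open>
  Pointwise only lower semicontinuity of the indicator of an open set along the flow is available,
  so just the positive part of the difference is controlled by dominated convergence. The group
  law turns the negative part for the time \<open>t\<close> into the positive part for \<open>- t\<close>.
\<close>

lemma indicator_open_flow_tendsto:
  assumes U: "open U" "U \<subseteq> \<Omega>" and fin: "emeasure M U < \<infinity>"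
  shows "((\<lambda>t. LINT x|M. \<bar>indicator U (\<gamma> t x) - indicator U x :: real\<bar>) \<longlongrightarrow> 0) (at 0)"
proof -
  have [measurable]: "U \<in> sets M"
    using U by (simp add: sets_M_iff)
  have int: "integrable M (indicator U :: 'a \<Rightarrow> real)"
    using fin by simp
  note int_flow = integrable_flow[OF int]
  define p where "p t x = max 0 (indicator U x - indicator U (\<gamma> t x) :: real)" for t x
  have p: "integrable M (p t)" for t
    unfolding p_def using int int_flow by (intro integrable_max Bochner_Integration.integrable_diff) auto
  have p_nonneg: "0 \<le> p t x" for t x
    by (simp add: p_def)
  have lim: "((\<lambda>t. LINT x|M. p t x) \<longlongrightarrow> 0) (at 0)"
    \<comment> \<open>Dominated convergence is applied along sequences of times tending to
      0.\<close>
    unfolding tendsto_at_iff_sequentially comp_def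
  proof (intro allI impI)
    fix s :: "nat \<Rightarrow> real" assume "\<forall>i. s i \<in> UNIV - {0}" and s: "s \<longlonglongrightarrow> 0"
    have "(\<lambda>i. LINT x|M. p (s i) x) \<longlonglongrightarrow> (LINT x|M. 0)"
    proof (rule integral_dominated_convergence[where w = "indicator U"])
      show "p (s i) \<in> borel_measurable M" for i
        using p by (rule borel_measurable_integrable)
      show "AE x in M. norm (p (s i) x) \<le> indicator U x" for i
        by (intro AE_I2) (auto simp: p_def split: split_indicator)
      show "AE x in M. (\<lambda>i. p (s i) x) \<longlonglongrightarrow> 0"
      proof (rule AE_I2)
        fix x assume "x \<in> space M"
        then have x: "x \<in> \<Omega>"
          by simp
        show "(\<lambda>i. p (s i) x) \<longlonglongrightarrow> 0"
        proof (cases "x \<in> U")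
          case True
          have "(\<lambda>i. \<gamma> (s i) x) \<longlonglongrightarrow> \<gamma> 0 x"
            using continuous_flow_time[OF x] s by (rule isCont_tendsto_compose)
          \<comment> \<open>Openness of \<open>U\<close> enters here: a point of \<open>U\<close>
            stays in \<open>U\<close> for small times.\<close>
          then have "\<forall>\<^sub>F i in sequentially. \<gamma> (s i) x \<in> U"
            using U True x by (simp add: flow_zero topological_tendstoD)
          then have "\<forall>\<^sub>F i in sequentially. p (s i) x = 0"
            by eventually_elim (use True in \<open>simp add: p_def\<close>)
          then show ?thesis
            by (rule tendsto_eventually)
        qed (simp add: p_def)
      qed
    qed (use int in auto)
    then show "(\<lambda>i. LINT x|M. p (s i) x) \<longlonglongrightarrow> 0"
      by simp
  qed
  have upper: "(LINT x|M. \<bar>indicator U (\<gamma> t x) - indicator U x :: real\<bar>) \<le>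
      (LINT x|M. p t x) + exp (real DIM('a) * L * \<bar>t\<bar>) * (LINT x|M. p (- t) x)" for t
  proof -
    have "(LINT x|M. \<bar>indicator U (\<gamma> t x) - indicator U x :: real\<bar>) =
        (LINT x|M. p t x + p (- t) (\<gamma> t x))"
    \<comment> \<open>The positive part at time \<open>- t\<close>, taken at the point
      \<open>\<gamma> t x\<close>, is the negative part at time \<open>t\<close>, taken at
      \<open>x\<close>.\<close>
    proof (rule Bochner_Integration.integral_cong[OF refl])
      fix x assume "x \<in> space M"
      then have "\<gamma> (- t) (\<gamma> t x) = x"
        by (simp add: flow_add flow_zero)
      then show "\<bar>indicator U (\<gamma> t x) - indicator U x :: real\<bar> = p t x + p (- t) (\<gamma> t x)"
        by (simp add: p_def split: split_indicator)
    qed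
    also have "\<dots> = (LINT x|M. p t x) + (LINT x|M. norm (p (- t) (\<gamma> t x)))"
      using p integrable_flow[OF p] p_nonneg by simp
    also have "\<dots> \<le> (LINT x|M. p t x) + exp (real DIM('a) * L * \<bar>t\<bar>) * (LINT x|M. p (- t) x)"
      using integral_norm_flow_le[OF p, of "- t" t] p_nonneg by simp
    finally show ?thesis .
  qed
  have "((\<lambda>t. LINT x|M. p (- t) x) \<longlongrightarrow> 0) (at 0)"
    by (rule filterlim_compose[OF lim])
      (auto simp: filterlim_at eventually_at_filter intro!: tendsto_eq_intros)
  then have "((\<lambda>t. (LINT x|M. p t x) + exp (real DIM('a) * L * \<bar>t\<bar>) * (LINT x|M. p (- t) x)) \<longlongrightarrow>
      0 + exp (real DIM('a) * L * \<bar>0\<bar>) * 0) (at 0)"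
    using lim by (intro tendsto_intros)
  then have lim': "((\<lambda>t. (LINT x|M. p t x) + exp (real DIM('a) * L * \<bar>t\<bar>) * (LINT x|M. p (- t) x)) \<longlongrightarrow> 0) (at 0)"
    by simp
  show ?thesis
    by (rule tendsto_sandwich[OF _ _ tendsto_const lim']) (auto intro!: always_eventually upper)
qed

text \<open>\<open>T\<^sub>t f - f = T\<^sub>t (f - g) + (T\<^sub>t g - g) - (f - g)\<close>, hence the constant.\<close>

lemma integral_flow_diff_le:
  fixes f g :: "'a \<Rightarrow> 'b::{banach, second_countable_topology}"
  assumes f: "integrable M f" and g: "integrable M g"
  shows "(LINT x|M. norm (f (\<gamma> t x) - f x)) \<le>
    (exp (real DIM('a) * L * \<bar>t\<bar>) + 1) * (LINT x|M. norm (f x - g x)) + (LINT x|M. norm (g (\<gamma> t x) - g x))"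
proof -
  note [simp] = f g integrable_flow[OF f] integrable_flow[OF g]
  have fg: "integrable M (\<lambda>x. f x - g x)"
    by simp
  note [simp] = integrable_flow[OF fg]
  have "(LINT x|M. norm (f (\<gamma> t x) - f x)) \<le>
      (LINT x|M. norm (f (\<gamma> t x) - g (\<gamma> t x)) + norm (g (\<gamma> t x) - g x) + norm (f x - g x))"
  proof (rule integral_mono)
    fix x
    have "norm (f (\<gamma> t x) - f x) =
        norm ((f (\<gamma> t x) - g (\<gamma> t x)) + (g (\<gamma> t x) - g x) - (f x - g x))"
      by simp
    also have "\<dots> \<le> norm ((f (\<gamma> t x) - g (\<gamma> t x)) + (g (\<gamma> t x) - g x)) + norm (f x - g x)"
      by (rule norm_triangle_ineq4)
    also have "norm ((f (\<gamma> t x) - g (\<gamma> t x)) + (g (\<gamma> t x) - g x)) \<le>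
        norm (f (\<gamma> t x) - g (\<gamma> t x)) + norm (g (\<gamma> t x) - g x)"
      by (rule norm_triangle_ineq)
    finally show "norm (f (\<gamma> t x) - f x) \<le>
        norm (f (\<gamma> t x) - g (\<gamma> t x)) + norm (g (\<gamma> t x) - g x) + norm (f x - g x)"
      by simp
  qed auto
  also have "\<dots> = (LINT x|M. norm (f (\<gamma> t x) - g (\<gamma> t x))) +
      (LINT x|M. norm (g (\<gamma> t x) - g x)) + (LINT x|M. norm (f x - g x))"
    by simp
  also have "(LINT x|M. norm (f (\<gamma> t x) - g (\<gamma> t x))) \<le>
      exp (real DIM('a) * L * \<bar>t\<bar>) * (LINT x|M. norm (f x - g x))"
    using fg by (rule integral_norm_flow_le)
  finally show ?thesis
    by (simp add: algebra_simps)
qed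

text \<open>Strong continuity at 0 is preserved under limits in the integral norm, since the
  operator bound stays bounded for \<open>t\<close> near 0.\<close>

lemma flow_tendsto_by_approx:
  fixes f :: "'a \<Rightarrow> 'b::{banach, second_countable_topology}"
  assumes f: "integrable M f"
    and approx: "\<And>e. 0 < e \<Longrightarrow> \<exists>g. integrable M g \<and> (LINT x|M. norm (f x - g x)) < e \<and>
      ((\<lambda>t. LINT x|M. norm (g (\<gamma> t x) - g x)) \<longlongrightarrow> 0) (at 0)"
  shows "((\<lambda>t. LINT x|M. norm (f (\<gamma> t x) - f x)) \<longlongrightarrow> 0) (at 0)"
proof (rule order_tendstoI)
  fix e :: real assume "0 < e"
  \<comment> \<open>As \<open>t\<close> tends to 0 the factor in front of this integral tends to 2,
    so the limit of the bound is below \<open>2 * e / 3\<close>.\<close>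
  then obtain g where g: "integrable M g" and fg: "(LINT x|M. norm (f x - g x)) < e / 3"
    and lim: "((\<lambda>t. LINT x|M. norm (g (\<gamma> t x) - g x)) \<longlongrightarrow> 0) (at 0)"
    using approx[of "e / 3"] by auto
  let ?D = "LINT x|M. norm (f x - g x)"
  have "((\<lambda>t. (exp (real DIM('a) * L * \<bar>t\<bar>) + 1) * ?D + (LINT x|M. norm (g (\<gamma> t x) - g x))) \<longlongrightarrow>
      (exp (real DIM('a) * L * \<bar>0\<bar>) + 1) * ?D + 0) (at 0)"
    using lim by (intro tendsto_intros)
  moreover have "(exp (real DIM('a) * L * \<bar>0\<bar>) + 1) * ?D + 0 < e"
    using fg \<open>0 < e\<close> by simp
  ultimately have "\<forall>\<^sub>F t in at 0.
      (exp (real DIM('a) * L * \<bar>t\<bar>) + 1) * ?D + (LINT x|M. norm (g (\<gamma> t x) - g x)) < e"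
    by (rule order_tendstoD)
  then show "\<forall>\<^sub>F t in at 0. (LINT x|M. norm (f (\<gamma> t x) - f x)) < e"
    by eventually_elim (use integral_flow_diff_le[OF f g] in \<open>rule order.strict_trans1\<close>)
next
  fix e :: real assume "e < 0"
  then show "\<forall>\<^sub>F t in at 0. e < (LINT x|M. norm (f (\<gamma> t x) - f x))"
    by (intro always_eventually allI) (auto intro: order.strict_trans2[of e 0])
qed

text \<open>By outer regularity \<open>A\<close> is approximated from outside by open sets of finite
  measure, for which the claim is known.\<close>

lemma indicator_flow_tendsto:
  assumes A: "A \<in> sets M" and fin: "emeasure M A < \<infinity>"
  shows "((\<lambda>t. LINT x|M. norm (indicator A (\<gamma> t x) - indicator A x :: real)) \<longlongrightarrow> 0) (at 0)"
proof (rule flow_tendsto_by_approx)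
  show "integrable M (indicator A :: 'a \<Rightarrow> real)"
    using A fin by simp
  fix e :: real assume "0 < e"
  have A': "A \<subseteq> \<Omega>" "A \<in> sets lebesgue"
    using A by (simp_all add: sets_M_iff)
  obtain V where V: "open V" "A \<subseteq> V" "V - A \<in> lmeasurable" "emeasure lebesgue (V - A) < ennreal e"
    by (rule sets_lebesgue_outer_open[OF A'(2) \<open>0 < e\<close>])
  \<comment> \<open>The open superset may leave the domain; cutting it back keeps it open because
    \<Omega> is open.\<close>
  define U where "U = V \<inter> \<Omega>"
  have U: "open U" "U \<subseteq> \<Omega>" "A \<subseteq> U"
    using V open_domain A' by (auto simp: U_def)
  then have U_sets: "U \<in> sets M"
    by (simp add: sets_M_iff)
  have "emeasure M (U - A) = emeasure lebesgue (U - A)"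
    using U(2) by (intro emeasure_restrict_space) auto
  also have "\<dots> \<le> emeasure lebesgue (V - A)"
    using V by (intro emeasure_mono) (auto simp: U_def)
  finally have UA: "emeasure M (U - A) < ennreal e"
    using V(4) by (rule order.strict_trans1)
  have "emeasure M U = emeasure M A + emeasure M (U - A)"
    using A U U_sets by (subst plus_emeasure) (auto simp: Un_absorb1)
  then have U_fin: "emeasure M U < \<infinity>"
    using fin UA by (auto simp: ennreal_add_less_top intro: order.strict_trans)
  have "(LINT x|M. norm (indicator A x - indicator U x :: real)) = (LINT x|M. indicator (U - A) x)"
    using U by (intro Bochner_Integration.integral_cong) (auto split: split_indicator)
  also have "\<dots> = measure M (U - A)"
  proof -
    have "(U - A) \<inter> space M = U - A"
      using U(2) by auto
    then show ?thesis
      by (simp only: Bochner_Integration.integral_indicator)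
  qed
  also have "\<dots> < e"
  proof -
    have "emeasure M (U - A) = ennreal (measure M (U - A))"
      using UA by (intro emeasure_eq_ennreal_measure) auto
    then show ?thesis
      using UA by (simp only: ennreal_less_iff measure_nonneg)
  qed
  finally have "(LINT x|M. norm (indicator A x - indicator U x :: real)) < e" .
  then show "\<exists>g. integrable M g \<and> (LINT x|M. norm (indicator A x - g x :: real)) < e \<and>
      ((\<lambda>t. LINT x|M. norm (g (\<gamma> t x) - g x)) \<longlongrightarrow> 0) (at 0)"
  proof (intro exI[of _ "indicator U"] conjI)
    show "integrable M (indicator U :: 'a \<Rightarrow> real)"
      using U_sets U_fin by simp
    show "((\<lambda>t. LINT x|M. norm (indicator U (\<gamma> t x) - indicator U x :: real)) \<longlongrightarrow> 0) (at 0)"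
      unfolding real_norm_def by (rule indicator_open_flow_tendsto[OF U(1,2) U_fin])
  qed
qed

text \<open>Induction over integrable functions: multiples of indicators of sets of finite measure,
  sums, and pointwise limits dominated by twice the limit. The last case is a limit in the integral
  norm as well.\<close>

lemma flow_tendsto_zero:
  fixes f :: "'a \<Rightarrow> 'b::{banach, second_countable_topology}"
  assumes "integrable M f"
  shows "((\<lambda>t. LINT x|M. norm (f (\<gamma> t x) - f x)) \<longlongrightarrow> 0) (at 0)"
  using assms
proof induction
  case (base A c)
  have "(LINT x|M. norm (indicator A (\<gamma> t x) *\<^sub>R c - indicator A x *\<^sub>R c)) =
      (LINT x|M. norm (indicator A (\<gamma> t x) - indicator A x :: real)) * norm c" for t
    by (simp add: scaleR_diff_left[symmetric])
  then show ?case
    using tendsto_mult_right[OF indicator_flow_tendsto[OF base], of "norm c"] by simp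
next
  case (add f g)
  note [simp] = add.hyps integrable_flow[OF add.hyps(1)] integrable_flow[OF add.hyps(2)]
  have upper: "(LINT x|M. norm (f (\<gamma> t x) + g (\<gamma> t x) - (f x + g x))) \<le>
      (LINT x|M. norm (f (\<gamma> t x) - f x)) + (LINT x|M. norm (g (\<gamma> t x) - g x))" for t
  proof -
    have "(LINT x|M. norm (f (\<gamma> t x) + g (\<gamma> t x) - (f x + g x))) \<le>
        (LINT x|M. norm (f (\<gamma> t x) - f x) + norm (g (\<gamma> t x) - g x))"
      by (rule integral_mono) (auto intro: norm_diff_triangle_ineq)
    then show ?thesis
      by simp
  qed
  have lim: "((\<lambda>t. (LINT x|M. norm (f (\<gamma> t x) - f x)) + (LINT x|M. norm (g (\<gamma> t x) - g x))) \<longlongrightarrow> 0) (at 0)"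
    using tendsto_add[OF add.IH] by simp
  show ?case
    by (rule tendsto_sandwich[OF _ _ tendsto_const lim]) (auto intro!: always_eventually upper)
next
  case (lim f s)
  note [measurable] = borel_measurable_integrable[OF lim.hyps(1)] borel_measurable_integrable[OF lim.hyps(4)]
  show ?case
  proof (rule flow_tendsto_by_approx[OF lim.hyps(4)])
    fix e :: real assume "0 < e"
    have "(\<lambda>i. LINT x|M. norm (f x - s i x)) \<longlonglongrightarrow> (LINT x|M. 0)"
    \<comment> \<open>The induction rule supplies \<open>norm (s i x) \<le> 2 * norm (f x)\<close>;
      adding \<open>norm (f x)\<close> for the difference gives the factor 3.\<close>
    proof (rule integral_dominated_convergence[where w = "\<lambda>x. 3 * norm (f x)"])
      show "AE x in M. (\<lambda>i. norm (f x - s i x)) \<longlonglongrightarrow> 0"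
      proof (rule AE_I2)
        fix x assume "x \<in> space M"
        then have "(\<lambda>i. norm (f x - s i x)) \<longlonglongrightarrow> norm (f x - f x)"
          by (intro tendsto_intros lim.hyps)
        then show "(\<lambda>i. norm (f x - s i x)) \<longlonglongrightarrow> 0"
          by simp
      qed
      show "AE x in M. norm (norm (f x - s i x)) \<le> 3 * norm (f x)" for i
      proof (rule AE_I2)
        fix x assume "x \<in> space M"
        then have "norm (s i x) \<le> 2 * norm (f x)"
          by (rule lim.hyps)
        then show "norm (norm (f x - s i x)) \<le> 3 * norm (f x)"
          using norm_triangle_ineq4[of "f x" "s i x"] by simp
      qed
    qed (use lim.hyps(4) in auto)
    then have "\<forall>\<^sub>F i in sequentially. (LINT x|M. norm (f x - s i x)) < e"
      using \<open>0 < e\<close> by (intro order_tendstoD(2)) auto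
    then obtain i where "(LINT x|M. norm (f x - s i x)) < e"
      using eventually_happens'[OF sequentially_bot] by blast
    then show "\<exists>g. integrable M g \<and> (LINT x|M. norm (f x - g x)) < e \<and>
        ((\<lambda>t. LINT x|M. norm (g (\<gamma> t x) - g x)) \<longlongrightarrow> 0) (at 0)"
      by (intro exI[of _ "s i"] conjI lim.hyps(1) lim.IH)
  qed
qed

subsection \<open>The one parameter group\<close>

text \<open>Representatives that agree almost everywhere still do so after composition with the
  flow, so all members of the union in \<open>flow_pullback\<close> coincide.\<close>

lemma flow_pullback_l1_class:
  fixes f :: "'a \<Rightarrow> 'b::{real_normed_field, banach, second_countable_topology}"
  assumes f: "integrable M f"
  shows "flow_pullback \<Omega> X t (l1_class M f) = l1_class M (f \<circ> \<gamma> t)"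
proof -
  have "l1_class M (g \<circ> \<gamma> t) = l1_class M (f \<circ> \<gamma> t)" if "g \<in> l1_class M f" for g
  proof -
    have g: "integrable M g" "AE x in M. f x = g x"
      using that by (simp_all add: mem_l1_class)
    have "AE x in M. f (\<gamma> t x) = g (\<gamma> t x)"
      using g(2) by (rule AE_flow)
    then show ?thesis
      using integrable_flow[OF f] integrable_flow[OF g(1)]
      by (subst l1_class_eq_iff) (simp_all add: comp_def eq_commute)
  qed
  then show ?thesis
    unfolding flow_pullback_def by (intro UN_constant_eq[OF l1_class_self[OF f]]) blast
qed

text \<open>With \<open>T t\<close> for composition with \<open>\<gamma> t\<close>, the difference
  \<open>T s g - T t f\<close> equals \<open>T t (g - f) - T s (T (t - s) g - g)\<close>. Joint
  continuity at \<open>(s, g)\<close> is thereby reduced to strong continuity at time 0 for the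
  fixed function \<open>g\<close>.\<close>

lemma integral_flow_flow_diff_le:
  fixes f g :: "'a \<Rightarrow> 'b::{banach, second_countable_topology}"
  assumes f: "integrable M f" and g: "integrable M g"
  shows "(LINT x|M. norm (g (\<gamma> s x) - f (\<gamma> t x))) \<le>
    exp (real DIM('a) * L * \<bar>t\<bar>) * (LINT x|M. norm (g x - f x)) +
    exp (real DIM('a) * L * \<bar>s\<bar>) * (LINT x|M. norm (g (\<gamma> (t - s) x) - g x))"
proof -
  have gf: "integrable M (\<lambda>x. g x - f x)" "integrable M (\<lambda>x. g (\<gamma> (t - s) x) - g x)"
    using f g integrable_flow[OF g] by simp_all
  note [simp] = integrable_flow[OF f] integrable_flow[OF g] integrable_flow[OF gf(1)]
  have "(LINT x|M. norm (g (\<gamma> s x) - f (\<gamma> t x))) \<le>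
      (LINT x|M. norm (g (\<gamma> t x) - f (\<gamma> t x)) + norm (g (\<gamma> t x) - g (\<gamma> s x)))"
  proof (rule integral_mono)
    show "norm (g (\<gamma> s x) - f (\<gamma> t x)) \<le> norm (g (\<gamma> t x) - f (\<gamma> t x)) + norm (g (\<gamma> t x) - g (\<gamma> s x))" for x
      using norm_triangle_ineq4[of "g (\<gamma> t x) - f (\<gamma> t x)" "g (\<gamma> t x) - g (\<gamma> s x)"] by simp
  qed auto
  also have "\<dots> = (LINT x|M. norm (g (\<gamma> t x) - f (\<gamma> t x))) + (LINT x|M. norm (g (\<gamma> t x) - g (\<gamma> s x)))"
    by simp
  also have "(LINT x|M. norm (g (\<gamma> t x) - g (\<gamma> s x))) =
      (LINT x|M. norm (g (\<gamma> (t - s) (\<gamma> s x)) - g (\<gamma> s x)))"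
    by (rule Bochner_Integration.integral_cong[OF refl]) (simp add: flow_add)
  finally show ?thesis
    using integral_norm_flow_le[OF gf(1), of t] integral_norm_flow_le[OF gf(2), of s] by linarith
qed

lemma jointly_continuous_flow_pullback:
  fixes B :: "('b::{real_normed_field, banach, second_countable_topology}, ('a \<Rightarrow> 'b) set) nspace"
  defines "B \<equiv> L1 M"
  shows "continuous_map (prod_topology euclideanreal (ntopology B)) (ntopology B)
    (\<lambda>(t, u). flow_pullback \<Omega> X t u)"
proof -
  interpret Metric_space "carr B" "ndist B"
    unfolding B_def by (rule Normed_space.Metric_space_ndist[OF Normed_space_L1])
  show ?thesis
    unfolding ntopology_def continuous_map_to_metric
  proof (clarsimp simp: split_paired_all)
    fix s :: real and v and e :: real
    assume "v \<in> carr B" "0 < e"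
    then obtain g where g: "integrable M g" and v: "v = l1_class M g"
      by (auto simp: B_def carr_L1)
    \<comment> \<open>A common bound for the operator norms at \<open>s\<close> and at all times
      within distance 1 of \<open>s\<close>; each of the two error terms then gets the share
      \<open>e / 2\<close>.\<close>
    define K where "K = exp (real DIM('a) * L * (\<bar>s\<bar> + 1))"
    have K: "0 < K" "exp (real DIM('a) * L * \<bar>s\<bar>) \<le> K"
      using L_nonneg by (auto simp: K_def intro!: mult_left_mono)
    have "0 < e / (2 * K)"
      using K \<open>0 < e\<close> by simp
    with flow_tendsto_zero[OF g]
    have "\<forall>\<^sub>F h in at 0. (LINT x|M. norm (g (\<gamma> h x) - g x)) < e / (2 * K)"
      by (rule order_tendstoD)
    then obtain d where "0 < d"
      and d: "\<And>h. h \<noteq> 0 \<Longrightarrow> \<bar>h\<bar> < d \<Longrightarrow> (LINT x|M. norm (g (\<gamma> h x) - g x)) < e / (2 * K)"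
      by (auto simp: eventually_at)
    \<comment> \<open>The limit at 0 says nothing about \<open>h = 0\<close>, which occurs when
      \<open>t = s\<close>, so this value is added by hand.\<close>
    have "(LINT x|M. norm (g (\<gamma> 0 x) - g x)) = (LINT x|M. 0)"
      by (rule Bochner_Integration.integral_cong) (simp_all add: flow_zero)
    with d \<open>0 < e / (2 * K)\<close>
    have d: "(LINT x|M. norm (g (\<gamma> h x) - g x)) < e / (2 * K)" if "\<bar>h\<bar> < d" for h
      using that by (cases "h = 0") simp_all
    \<comment> \<open>Radius 1 in time secures the bound by \<open>K\<close>, radius
      \<open>d\<close> the smallness of the second error term.\<close>
    define W where "W = ball s (min 1 d) \<times> mball v (e / (2 * K))"
    have "flow_pullback \<Omega> X t u \<in> mball (flow_pullback \<Omega> X s v) e" if "(t, u) \<in> W" for t u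
    proof -
      have t: "\<bar>t\<bar> \<le> \<bar>s\<bar> + 1" "\<bar>t - s\<bar> < d"
        using that by (auto simp: W_def dist_real_def)
      have "u \<in> carr B"
        using that by (simp add: W_def)
      then obtain f where f: "integrable M f" and u: "u = l1_class M f"
        by (auto simp: B_def carr_L1)
      have dist: "(LINT x|M. norm (g x - f x)) < e / (2 * K)"
      proof -
        have "ndist B v u < e / (2 * K)"
          using that by (simp add: W_def)
        then show ?thesis
          using f g by (simp add: u v B_def ndist_L1)
      qed
      have K_t: "exp (real DIM('a) * L * \<bar>t\<bar>) \<le> K"
        using t(1) L_nonneg by (auto simp: K_def intro!: mult_left_mono)
      have "(LINT x|M. norm (g (\<gamma> s x) - f (\<gamma> t x))) \<le>
          exp (real DIM('a) * L * \<bar>t\<bar>) * (LINT x|M. norm (g x - f x)) +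
          exp (real DIM('a) * L * \<bar>s\<bar>) * (LINT x|M. norm (g (\<gamma> (t - s) x) - g x))"
        using f g by (rule integral_flow_flow_diff_le)
      also have "\<dots> \<le> K * (LINT x|M. norm (g x - f x)) + K * (LINT x|M. norm (g (\<gamma> (t - s) x) - g x))"
        using K K_t by (intro add_mono mult_right_mono) auto
      also have "\<dots> < K * (e / (2 * K)) + K * (e / (2 * K))"
        using K dist d[OF t(2)] by (intro add_strict_mono mult_strict_left_mono)
      also have "\<dots> = e"
        using K by simp
      finally have "(LINT x|M. norm (g (\<gamma> s x) - f (\<gamma> t x))) < e" .
      then show ?thesis
        using integrable_flow[OF f] integrable_flow[OF g] f g
        unfolding in_mball
        by (simp add: u v B_def flow_pullback_l1_class carr_L1 ndist_L1 comp_def)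
    qed
    moreover have "openin (prod_topology euclideanreal mtopology) W"
      unfolding W_def by (simp add: openin_prod_Times_iff)
    moreover have "(s, v) \<in> W"
      using \<open>v \<in> carr B\<close> \<open>0 < d\<close> \<open>0 < e / (2 * K)\<close> by (simp add: W_def)
    ultimately show "\<exists>W. openin (prod_topology euclideanreal mtopology) W \<and> (s, v) \<in> W \<and>
        (\<forall>y\<in>W. (case y of (t, u) \<Rightarrow> flow_pullback \<Omega> X t u) \<in> mball (flow_pullback \<Omega> X s v) e)"
      by (intro exI[of _ W] conjI) (auto simp del: in_mball)
  qed
qed

lemma linear_operator_flow_pullback:
  fixes B :: "('b::{real_normed_field, banach, second_countable_topology}, ('a \<Rightarrow> 'b) set) nspace"
  defines "B \<equiv> L1 M"
  shows "linear_operator B (flow_pullback \<Omega> X t)"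
  unfolding linear_operator_def
  using integrable_flow
  by (auto simp: B_def carr_L1 add_L1 scl_L1 flow_pullback_l1_class comp_def)

lemma flow_pullback_group:
  fixes B :: "('b::{real_normed_field, banach, second_countable_topology}, ('a \<Rightarrow> 'b) set) nspace"
  defines "B \<equiv> L1 M"
  shows "c0_one_parameter_group B (flow_pullback \<Omega> X)"
proof -
  interpret Banach_space B
    unfolding B_def by (rule Banach_space_L1)
  show ?thesis
  proof
    show "linear_operator B (flow_pullback \<Omega> X t)" for t
      unfolding B_def by (rule linear_operator_flow_pullback)
    show "continuous_map (prod_topology euclideanreal (ntopology B)) (ntopology B)
        (\<lambda>(t, u). flow_pullback \<Omega> X t u)"
      unfolding B_def by (rule jointly_continuous_flow_pullback)
    fix u assume "u \<in> carr B"
    then obtain f where f: "integrable M f" and u: "u = l1_class M f"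
      by (auto simp: B_def carr_L1)
    note int = integrable_flow[OF f]
    show "flow_pullback \<Omega> X 0 u = u"
    proof -
      have "AE x in M. f (\<gamma> 0 x) = f x"
        by (rule AE_I2) (simp add: flow_zero)
      then show ?thesis
        using f int by (simp add: u flow_pullback_l1_class comp_def l1_class_eq_iff)
    qed
    show "flow_pullback \<Omega> X t (flow_pullback \<Omega> X s u) = flow_pullback \<Omega> X (t + s) u" for t s
    proof -
      \<comment> \<open>Pulling back reverses the order of composition; this is harmless because
        times add commutatively.\<close>
      have "AE x in M. f (\<gamma> s (\<gamma> t x)) = f (\<gamma> (t + s) x)"
        by (rule AE_I2) (simp add: flow_add add.commute)
      then show ?thesis
        using f int integrable_flow[OF int]
        by (simp add: u flow_pullback_l1_class comp_def l1_class_eq_iff)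
    qed
  qed
qed

lemma operator_norm_flow_pullback_le:
  fixes B :: "('b::{real_normed_field, banach, second_countable_topology}, ('a \<Rightarrow> 'b) set) nspace"
  defines "B \<equiv> L1 M"
  shows "operator_norm B (flow_pullback \<Omega> X t) \<le> ereal (exp (real DIM('a) * L * \<bar>t\<bar>))"
  unfolding operator_norm_def
proof (rule SUP_least)
  fix u assume "u \<in> {u \<in> carr B. nrm B u \<le> 1}"
  then obtain f where f: "integrable M f" and u: "u = l1_class M f" and le: "(LINT x|M. norm (f x)) \<le> 1"
    by (auto simp: B_def carr_L1 nrm_L1)
  have "(LINT x|M. norm (f (\<gamma> t x))) \<le> exp (real DIM('a) * L * \<bar>t\<bar>) * (LINT x|M. norm (f x))"
    using f by (rule integral_norm_flow_le)
  also have "\<dots> \<le> exp (real DIM('a) * L * \<bar>t\<bar>)"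
    using le by (simp add: mult_left_le)
  finally show "ereal (nrm B (flow_pullback \<Omega> X t u)) \<le> ereal (exp (real DIM('a) * L * \<bar>t\<bar>))"
    using f integrable_flow[OF f] by (simp add: u B_def flow_pullback_l1_class comp_def nrm_L1)
qed

end

theorem theorem4p5:
  fixes \<Omega> :: "(real ^ 'n) set" and X :: "real ^ 'n \<Rightarrow> real ^ 'n" and L :: real
    and B :: "('b::{real_normed_field, banach, second_countable_topology},
               (real ^ 'n \<Rightarrow> 'b) set) nspace"
  assumes "open \<Omega>"
    and "L-lipschitz_on \<Omega> X"
    and "complete_vector_field \<Omega> X"
    and "B = L1 (lebesgue_on \<Omega>)"
  shows "(\<forall>t. \<forall>f :: real ^ 'n \<Rightarrow> 'b. integrable (lebesgue_on \<Omega>) f \<longrightarrow>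
            integrable (lebesgue_on \<Omega>) (f \<circ> flow \<Omega> X t) \<and>
            flow_pullback \<Omega> X t (l1_class (lebesgue_on \<Omega>) f)
              = l1_class (lebesgue_on \<Omega>) (f \<circ> flow \<Omega> X t)) \<and>
         c0_one_parameter_group B (flow_pullback \<Omega> X) \<and>
         (\<forall>t. operator_norm B (flow_pullback \<Omega> X t) \<le> ereal (exp (real CARD('n) * L * \<bar>t\<bar>)))"
proof -
  interpret complete_lipschitz_field \<Omega> X L
    using assms(1-3) by unfold_locales
  have "operator_norm B (flow_pullback \<Omega> X t) \<le> ereal (exp (real CARD('n) * L * \<bar>t\<bar>))" for t
    \<comment> \<open>On \<open>real ^ 'n\<close> the dimension \<open>DIM\<close> simplifies to
      \<open>CARD('n)\<close>.\<close>
    using operator_norm_flow_pullback_le[where 'b = 'b, of t] by (simp add: \<open>B = L1 M\<close>)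
  moreover have "c0_one_parameter_group B (flow_pullback \<Omega> X)"
    unfolding \<open>B = L1 M\<close> by (rule flow_pullback_group)
  ultimately show ?thesis
    by (simp add: integrable_flow flow_pullback_l1_class comp_def)
qed

end
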